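(* Fix an iteration index $t$ with a point $x_t\in\mathbb R^d$ and multiplier $\mu_t\in\mathbb R^m$, and let $H_t$, $B_t$, $M_t$, $C_{{\rm aug},t}$, $C_{{\rm opt},t}$ be defined as in the closed-form hybrid design described in the context, with target margin $\delta>0$. Assume $B_t$ has full column rank and $R_t\succ 0$. Then $$H_t+B_t^\top M_tB_t\succeq \delta I,\qquad C_{{\rm aug},t}+C_{{\rm opt},t}=M_t.$$ Consequently, the hybrid realization has the same primal trajectory as the pure realization using the full correction $M_t$, under matched effective-dual initialization. That is, let $(C,\Omega)=(C_{{\rm aug},t},C_{{\rm opt},t})$ and let $(C',\Omega')$ be either $(0,M_t)$ (pure optimistic) or $(M_t,0)$ (pure augmented). If $ALG(C,\Omega)$ and $ALG(C',\Omega')$ are run with the same $f,h,\eta_x,\eta_{\rm d}$, with the same initial primal history $(x_{-1},x_0)$, and with initial dual variables $\mu_0,\mu_0'$ satisfying $\mu_0+C\,h(x_{-1})=\mu_0'+C'h(x_{-1})$, then they generate the same primal iterates at every step.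
   Context: Let $f:\mathbb R^d\to\mathbb R$ and $h:\mathbb R^d\to\mathbb R^m$ be twice continuously differentiable, $\mathcal L(x,\mu)=f(x)+\mu^\top h(x)$, and let $J_h(x)\in\mathbb R^{m\times d}$ be the Jacobian of $h$. $A^\dagger$ denotes the Moore--Penrose pseudoinverse, $A^{\dagger\top}=(A^\dagger)^\top$, and $\|\cdot\|_2$ the induced 2-norm. Closed-form hybrid design at iteration $t$: set $H_t=\nabla^2_{xx}\mathcal L(x_t,\mu_t)$ and $B_t=J_h(x_t)$; let $R_t\in\mathbb R^{m\times m}$ be a chosen symmetric positive definite matrix (residual metric), and let $\delta,\kappa_x,\kappa_p,\kappa_\omega>0$ be constants. Define $$C_{{\rm can},t}=-B_t^{\dagger\top}H_tB_t^\dagger,\qquad \alpha_t=\frac{\delta}{\lambda_{\min}(B_t^\top R_tB_t)},\qquad M_t=C_{{\rm can},t}+\alpha_tR_t,$$ $$\theta_t=\frac{\kappa_x\|R_t\|_2\|B_t\|_2^2}{\kappa_x\|R_t\|_2\|B_t\|_2^2+\kappa_p\kappa_\omega\|B_t^\top R_tB_t\|_2},$$ $$C_{{\rm aug},t}=C_{{\rm can},t}+\theta_t\alpha_tR_t,\qquad C_{{\rm opt},t}=(1-\theta_t)\alpha_tR_t.$$ For step sizes $\eta_x,\eta_{\rm d}>0$ and matrices $C,\Omega\in\mathbb R^{m\times m}$, the method $ALG(C,\Omega)$, started from given $x_{-1},x_0\in\mathbb R^d$ and $\mu_0\in\mathbb R^m$, is the iteration, for $s\ge 0$, $$\mu_{s+1}=\mu_s+\eta_{\rm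 d}h(x_s)+\Omega\big(h(x_s)-h(x_{s-1})\big),$$ $$x_{s+1}=x_s-\eta_x\Big[\nabla f(x_s)+J_h(x_s)^\top\big(\mu_{s+1}+C\,h(x_s)\big)\Big].$$ Its effective dual variable is $\mu_s+C\,h(x_{s-1})$. (In $ALG$ the iterates are indexed by $s$, and the correction matrices $C,\Omega$ are held fixed along the iteration.) *)

theory Defs
  imports "HOL-Analysis.Analysis"
begin

definition twice_cont_differentiable :: "('a::real_normed_vector \<Rightarrow> 'b::real_normed_vector) \<Rightarrow> bool"
  where "twice_cont_differentiable g \<longleftrightarrow>
    (\<exists>(g' :: 'a \<Rightarrow> ('a \<Rightarrow>\<^sub>L 'b)) (g'' :: 'a \<Rightarrow> ('a \<Rightarrow>\<^sub>L ('a \<Rightarrow>\<^sub>L 'b))).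
       (\<forall>x. (g has_derivative blinfun_apply (g' x)) (at x)) \<and>
       (\<forall>x. (g' has_derivative blinfun_apply (g'' x)) (at x)) \<and>
       continuous_on UNIV g'')"

definition gradient :: "(real^'d \<Rightarrow> real) \<Rightarrow> real^'d \<Rightarrow> real^'d"
  where "gradient g x = (THE D. GDERIV g x :> D)"

definition hessian :: "(real^'d \<Rightarrow> real) \<Rightarrow> real^'d \<Rightarrow> real^'d^'d"
  where "hessian g x = jacobian (gradient g) (at x)"

definition lagrangian ::
    "(real^'d \<Rightarrow> real) \<Rightarrow> (real^'d \<Rightarrow> real^'m) \<Rightarrow> real^'d \<Rightarrow> real^'m \<Rightarrow> real"
  where "lagrangian f h x \<mu> = f x + \<mu> \<bullet> h x"

definition matrix_norm2 :: "real^'n^'m \<Rightarrow> real"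
  where "matrix_norm2 A = onorm ((*v) A)"

text \<open>Positive (semi)definiteness, and with it the Loewner order, includes symmetry.\<close>

definition pos_def :: "real^'n^'n \<Rightarrow> bool"
  where "pos_def A \<longleftrightarrow> transpose A = A \<and> (\<forall>v. v \<noteq> 0 \<longrightarrow> 0 < v \<bullet> (A *v v))"

definition pos_semidef :: "real^'n^'n \<Rightarrow> bool"
  where "pos_semidef A \<longleftrightarrow> transpose A = A \<and> (\<forall>v. 0 \<le> v \<bullet> (A *v v))"

definition loewner_ge :: "real^'n^'n \<Rightarrow> real^'n^'n \<Rightarrow> bool"
  where "loewner_ge A B \<longleftrightarrow> pos_semidef (A - B)"

definition eigenvalue_of :: "real^'n^'n \<Rightarrow> real \<Rightarrow> bool"
  where "eigenvalue_of A l \<longleftrightarrow> (\<exists>v. v \<noteq> 0 \<and> A *v v = l *\<^sub>R v)"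

text \<open>Only meaningful when \<open>A\<close> has a real eigenvalue, in particular for symmetric \<open>A\<close>.\<close>

definition lambda_min :: "real^'n^'n \<Rightarrow> real"
  where "lambda_min A = (LEAST l. eigenvalue_of A l)"

text \<open>The four Penrose conditions.\<close>

definition is_pseudoinverse :: "real^'n^'m \<Rightarrow> real^'m^'n \<Rightarrow> bool"
  where "is_pseudoinverse A X \<longleftrightarrow>
     A ** X ** A = A \<and> X ** A ** X = X \<and>
     transpose (A ** X) = A ** X \<and> transpose (X ** A) = X ** A"

definition pinv :: "real^'n^'m \<Rightarrow> real^'m^'n"
  where "pinv A = (THE X. is_pseudoinverse A X)"

definition C_can :: "real^'d^'d \<Rightarrow> real^'d^'m \<Rightarrow> real^'m^'m"
  where "C_can H B = - (transpose (pinv B) ** H ** pinv B)"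

definition alpha :: "real \<Rightarrow> real^'d^'m \<Rightarrow> real^'m^'m \<Rightarrow> real"
  where "alpha \<delta> B R = \<delta> / lambda_min (transpose B ** R ** B)"

definition M_full :: "real \<Rightarrow> real^'d^'d \<Rightarrow> real^'d^'m \<Rightarrow> real^'m^'m \<Rightarrow> real^'m^'m"
  where "M_full \<delta> H B R = C_can H B + alpha \<delta> B R *\<^sub>R R"

definition theta :: "real \<Rightarrow> real \<Rightarrow> real \<Rightarrow> real^'d^'m \<Rightarrow> real^'m^'m \<Rightarrow> real"
  where "theta \<kappa>x \<kappa>p \<kappa>\<omega> B R =
    \<kappa>x * matrix_norm2 R * (matrix_norm2 B)\<^sup>2 /
      (\<kappa>x * matrix_norm2 R * (matrix_norm2 B)\<^sup>2
        + \<kappa>p * \<kappa>\<omega> * matrix_norm2 (transpose B ** R ** B))"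

definition C_aug ::
    "real \<Rightarrow> real \<Rightarrow> real \<Rightarrow> real \<Rightarrow> real^'d^'d \<Rightarrow> real^'d^'m \<Rightarrow> real^'m^'m \<Rightarrow> real^'m^'m"
  where "C_aug \<delta> \<kappa>x \<kappa>p \<kappa>\<omega> H B R =
    C_can H B + (theta \<kappa>x \<kappa>p \<kappa>\<omega> B R * alpha \<delta> B R) *\<^sub>R R"

definition C_opt ::
    "real \<Rightarrow> real \<Rightarrow> real \<Rightarrow> real \<Rightarrow> real^'d^'m \<Rightarrow> real^'m^'m \<Rightarrow> real^'m^'m"
  where "C_opt \<delta> \<kappa>x \<kappa>p \<kappa>\<omega> B R =
    ((1 - theta \<kappa>x \<kappa>p \<kappa>\<omega> B R) * alpha \<delta> B R) *\<^sub>R R"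

text \<open>The state after \<open>s\<close> steps is the triple of \<open>x\<close> at \<open>s - 1\<close>, \<open>x\<close> at \<open>s\<close> and \<open>\<mu>\<close> at \<open>s\<close>,
  so that the starting history at index \<open>-1\<close> needs no negative index.\<close>

primrec alg_state ::
    "(real^'d \<Rightarrow> real) \<Rightarrow> (real^'d \<Rightarrow> real^'m) \<Rightarrow> real \<Rightarrow> real \<Rightarrow> real^'m^'m \<Rightarrow> real^'m^'m
      \<Rightarrow> real^'d \<Rightarrow> real^'d \<Rightarrow> real^'m \<Rightarrow> nat \<Rightarrow> (real^'d) \<times> (real^'d) \<times> (real^'m)"
  where
    "alg_state f h \<eta>x \<eta>d C \<Omega> x_prev x_init \<mu>_init 0 = (x_prev, x_init, \<mu>_init)"
  | "alg_state f h \<eta>x \<eta>d C \<Omega> x_prev x_init \<mu>_init (Suc s) =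
      (case alg_state f h \<eta>x \<eta>d C \<Omega> x_prev x_init \<mu>_init s of (y, x, \<mu>) \<Rightarrow>
        let \<mu>' = \<mu> + \<eta>d *\<^sub>R h x + \<Omega> *v (h x - h y);
            x' = x - \<eta>x *\<^sub>R (gradient f x + transpose (jacobian h (at x)) *v (\<mu>' + C *v h x))
        in (x, x', \<mu>'))"

definition alg_primal ::
    "(real^'d \<Rightarrow> real) \<Rightarrow> (real^'d \<Rightarrow> real^'m) \<Rightarrow> real \<Rightarrow> real \<Rightarrow> real^'m^'m \<Rightarrow> real^'m^'m
      \<Rightarrow> real^'d \<Rightarrow> real^'d \<Rightarrow> real^'m \<Rightarrow> nat \<Rightarrow> real^'d"
  where "alg_primal f h \<eta>x \<eta>d C \<Omega> x_prev x_init \<mu>_init s =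
    fst (snd (alg_state f h \<eta>x \<eta>d C \<Omega> x_prev x_init \<mu>_init s))"

end

theory Submission
  imports Defs
begin

text \<open>With full column rank, \<open>pinv B\<close> is a left inverse of \<open>B\<close>, so the canonical part of \<open>M\<close>
  cancels \<open>H\<close> exactly and \<open>H + B\<^sup>T M B = \<alpha> B\<^sup>T R B\<close>, which the choice of \<open>\<alpha>\<close> bounds below by \<open>\<delta> I\<close>.
  For the trajectories, the effective dual
  \<open>\<mu>\<^sub>s + C h(x\<^sub>s\<^sub>-\<^sub>1)\<close> obeys a recursion in which \<open>C\<close> and \<open>\<Omega>\<close> enter only through \<open>C + \<Omega>\<close>, and it is all
  that the primal update sees of the dual.\<close>

text \<open>If \<open>w = A *v u\<close> were nonzero, a small move from \<open>u\<close> against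
  \<open>w\<close> would make the quadratic form negative: its first-order change is negative and
  outweighs the second-order one.\<close>

lemma pos_semidef_null_vector:
  fixes A :: "real^'n^'n"
  assumes "pos_semidef A" and "u \<bullet> (A *v u) = 0"
  shows "A *v u = 0"
proof (rule ccontr)
  define w where "w = A *v u"
  define n where "n = w \<bullet> w"
  define k where "k = w \<bullet> (A *v w)"
  \<comment> \<open>The exact minimiser of \<open>2 * t * n + t\<^sup>2 * k\<close> is
    \<open>- n / k\<close>; the added 1 covers \<open>k = 0\<close> and keeps the value
    negative.\<close>
  define t where "t = - n / (k + 1)"
  assume "A *v u \<noteq> 0"
  then have n: "n > 0" by (simp add: n_def w_def)
  have k: "k \<ge> 0" using assms(1) by (simp add: k_def pos_semidef_def)
  have sym: "transpose A = A" using assms(1) by (simp add: pos_semidef_def)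
  have uw: "u \<bullet> (A *v w) = n"
    using sym by (metis dot_lmul_matrix n_def vector_transpose_matrix w_def)
  have "(u + t *\<^sub>R w) \<bullet> (A *v (u + t *\<^sub>R w)) = 2 * t * n + t\<^sup>2 * k"
    using assms(2) uw
    by (simp add: matrix_vector_right_distrib inner_add_left inner_add_right
        matrix_vector_mult_scaleR k_def n_def power2_eq_square distrib_left flip: w_def)
  also have "\<dots> = n\<^sup>2 / (k + 1) * (k / (k + 1) - 2)"
    using k by (simp add: t_def power2_eq_square divide_simps) (simp add: algebra_simps)
  also have "\<dots> < 0"
    using n k by (intro mult_pos_neg) (auto simp: divide_simps)
  finally show False
    using assms(1) by (simp add: pos_semidef_def not_le[symmetric])
qed

text \<open>The minimum of the quadratic form over the unit sphere is attained, and a minimiser is an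
  eigenvector, which makes the \<open>LEAST\<close> in \<open>lambda_min\<close> well defined.\<close>

lemma lambda_min_symmetric:
  fixes S :: "real^'n^'n"
  assumes "transpose S = S"
  shows eigenvalue_of_lambda_min: "eigenvalue_of S (lambda_min S)"
    and loewner_ge_lambda_min: "loewner_ge S (lambda_min S *\<^sub>R mat 1)"
proof -
  have "compact (sphere (0 :: real^'n) 1)" by simp
  moreover have "sphere (0 :: real^'n) 1 \<noteq> {}" by simp
  moreover have "continuous_on (sphere 0 1) (\<lambda>v. v \<bullet> (S *v v))"
    by (intro continuous_intros linear_continuous_on matrix_vector_mul_bounded_linear)
  ultimately obtain u where u: "norm u = 1"
    and u_min: "\<And>v. norm v = 1 \<Longrightarrow> u \<bullet> (S *v u) \<le> v \<bullet> (S *v v)"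
    using continuous_attains_inf[of "sphere 0 1" "\<lambda>v. v \<bullet> (S *v v)"] by auto
  define l where "l = u \<bullet> (S *v u)"
  have shift: "(S - l *\<^sub>R mat 1) *v v = S *v v - l *\<^sub>R v" for v
    by (simp add: matrix_vector_mult_diff_rdistrib flip: scaleR_matrix_vector_assoc)
  have bound: "l * (v \<bullet> v) \<le> v \<bullet> (S *v v)" for v
  proof (cases "v = 0")
    case False
    have "l \<le> (v /\<^sub>R norm v) \<bullet> (S *v (v /\<^sub>R norm v))"
      unfolding l_def using False by (intro u_min) simp
    also have "\<dots> = (v \<bullet> (S *v v)) / (v \<bullet> v)"
      by (simp add: matrix_vector_mult_scaleR divide_simps power2_norm_eq_inner[symmetric]
          power2_eq_square)
    finally show ?thesis using False by (simp add: divide_simps)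
  qed simp
  have psd: "pos_semidef (S - l *\<^sub>R mat 1)"
    unfolding pos_semidef_def shift
  proof
    show "transpose (S - l *\<^sub>R mat 1) = S - l *\<^sub>R mat 1"
      using assms by (auto simp: transpose_def mat_def vec_eq_iff)
  qed (use bound in \<open>simp add: inner_diff_right\<close>)
  \<comment> \<open>The minimiser is a zero of a positive semidefinite form, hence lies in its
    kernel; this replaces a Lagrange multiplier argument.\<close>
  have "u \<bullet> ((S - l *\<^sub>R mat 1) *v u) = 0"
    using u by (simp add: shift inner_diff_right dot_square_norm flip: l_def)
  then have "S *v u = l *\<^sub>R u"
    using pos_semidef_null_vector[OF psd] by (simp add: shift)
  then have eig: "eigenvalue_of S l"
    using u unfolding eigenvalue_of_def by (intro exI[of _ u]) auto
  have "l \<le> l'" if "eigenvalue_of S l'" for l'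
  proof -
    obtain v where "v \<noteq> 0" "S *v v = l' *\<^sub>R v"
      using \<open>eigenvalue_of S l'\<close> by (auto simp: eigenvalue_of_def)
    with bound[of v] show ?thesis by simp
  qed
  with eig have "lambda_min S = l"
    unfolding lambda_min_def by (rule Least_equality)
  then show "eigenvalue_of S (lambda_min S)" "loewner_ge S (lambda_min S *\<^sub>R mat 1)"
    using eig psd by (simp_all add: loewner_ge_def)
qed

lemma lambda_min_pos:
  fixes S :: "real^'n^'n"
  assumes "pos_def S"
  shows "lambda_min S > 0"
proof -
  obtain v where v: "v \<noteq> 0" "S *v v = lambda_min S *\<^sub>R v"
    using eigenvalue_of_lambda_min assms by (auto simp: pos_def_def eigenvalue_of_def)
  then have "0 < lambda_min S * (v \<bullet> v)"
    using assms unfolding pos_def_def by (metis inner_scaleR_right)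
  then show ?thesis by (rule zero_less_mult_pos2) (simp add: v(1))
qed

lemma inner_transpose_congruence:
  fixes A :: "real^'n^'m" and R :: "real^'m^'m"
  shows "v \<bullet> ((transpose A ** R ** A) *v v) = (A *v v) \<bullet> (R *v (A *v v))"
  using dot_lmul_matrix[of v "transpose A" "R *v (A *v v)"]
  by (simp flip: matrix_vector_mul_assoc transpose_matrix_vector)

text \<open>Applied to the metric \<open>R\<close>, and with the identity in its place to the Gram
  matrix behind the pseudoinverse.\<close>

lemma pos_def_congruence:
  fixes A :: "real^'n^'m" and R :: "real^'m^'m"
  assumes "rank A = CARD('n)" and "pos_def R"
  shows "pos_def (transpose A ** R ** A)"
proof -
  have "inj ((*v) A)" using assms(1) full_rank_injective by blast
  then have "A *v v \<noteq> 0" if "v \<noteq> 0" for v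
    using that by (metis injD matrix_vector_mult_0_right)
  then show ?thesis
    using assms(2)
    by (auto simp: pos_def_def inner_transpose_congruence matrix_transpose_mul matrix_mul_assoc)
qed

text \<open>\<open>A ** X\<close> and \<open>A ** Y\<close> are both the orthogonal projection onto
  the range of \<open>A\<close>, hence equal; likewise \<open>X ** A = Y ** A\<close>. Then
  \<open>X = X ** A ** X = Y ** A ** Y = Y\<close>. This justifies the \<open>THE\<close> in
  \<open>pinv\<close>.\<close>

lemma is_pseudoinverse_unique:
  fixes A :: "real^'n^'m"
  assumes "is_pseudoinverse A X" and "is_pseudoinverse A Y"
  shows "X = Y"
proof -
  have "A ** Y = (A ** X) ** (A ** Y)"
    using assms by (metis is_pseudoinverse_def matrix_mul_assoc)
  also have "\<dots> = transpose ((A ** Y) ** (A ** X))"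
    using assms by (simp add: matrix_transpose_mul is_pseudoinverse_def)
  also have "\<dots> = A ** X"
    using assms by (metis is_pseudoinverse_def matrix_mul_assoc)
  finally have AY: "A ** Y = A ** X" .
  have "Y ** A = (Y ** A) ** (X ** A)"
    using assms by (metis is_pseudoinverse_def matrix_mul_assoc)
  also have "\<dots> = transpose ((X ** A) ** (Y ** A))"
    using assms by (simp add: matrix_transpose_mul is_pseudoinverse_def)
  also have "\<dots> = X ** A"
    using assms by (metis is_pseudoinverse_def matrix_mul_assoc)
  finally have "Y ** A = X ** A" .
  with AY show ?thesis
    using assms by (metis is_pseudoinverse_def matrix_mul_assoc)
qed

text \<open>Full column rank makes the Gram matrix \<open>G\<close> invertible, and its inverse
  times \<open>transpose A\<close> satisfies the Penrose conditions.\<close>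

lemma pinv_left_inverse:
  fixes A :: "real^'n^'m"
  assumes "rank A = CARD('n)"
  shows "pinv A ** A = mat 1"
proof -
  define G where "G = transpose A ** A"
  have "pos_def (mat 1 :: real^'m^'m)"
    by (simp add: pos_def_def)
  from pos_def_congruence[OF assms this] have G: "pos_def G"
    by (simp add: G_def)
  have "v = 0" if "G *v v = 0" for v
    using G that unfolding pos_def_def by (metis inner_zero_right less_irrefl)
  then obtain K where K: "K ** G = mat 1"
    by (meson matrix_left_invertible_ker)
  \<comment> \<open>\<open>G\<close> is symmetric, so transposing \<open>K ** G = mat 1\<close>
    gives a right inverse, which must coincide with the left one. The resulting symmetry of
    \<open>K\<close> is what makes \<open>A ** X\<close> symmetric.\<close>
  then have "G ** transpose K = mat 1"
    using G by (metis matrix_transpose_mul pos_def_def transpose_mat)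
  with K have sym: "transpose K = K"
    by (metis matrix_mul_assoc matrix_mul_lid matrix_mul_rid)
  define X where "X = K ** transpose A"
  have XA: "X ** A = mat 1"
    using K by (simp add: X_def G_def matrix_mul_assoc)
  have "transpose (A ** X) = A ** X"
    by (simp add: X_def matrix_transpose_mul sym matrix_mul_assoc)
  with XA have "is_pseudoinverse A X"
    by (simp add: is_pseudoinverse_def flip: matrix_mul_assoc)
  then have "pinv A = X"
    unfolding pinv_def by (blast intro: is_pseudoinverse_unique)
  with XA show ?thesis by simp
qed

lemma matrix_add_rdistrib: "(A + B) ** C = A ** C + B ** C"
  by (simp add: matrix_matrix_mult_def vec_eq_iff distrib_right sum.distrib)

lemma transpose_mult_C_can_mult:
  fixes B :: "real^'d^'m"
  assumes "rank B = CARD('d)"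
  shows "transpose B ** C_can H B ** B = - H"
proof -
  \<comment> \<open>The sign is written as a scalar so that the rules for scalars in matrix products
    can pull it out.\<close>
  have "C_can H B = (-1) *\<^sub>R (transpose (pinv B) ** H ** pinv B)"
    by (simp add: C_can_def)
  then have "transpose B ** C_can H B ** B
      = (-1) *\<^sub>R (transpose B ** (transpose (pinv B) ** H ** pinv B) ** B)"
    by (simp only: matrix_scalar_ac scalar_matrix_assoc[symmetric])
  also have "transpose B ** (transpose (pinv B) ** H ** pinv B) ** B
      = transpose (pinv B ** B) ** H ** (pinv B ** B)"
    by (simp add: matrix_transpose_mul matrix_mul_assoc)
  also have "\<dots> = H" by (simp add: pinv_left_inverse[OF assms])
  finally show ?thesis by simp
qed

text \<open>Once \<open>H\<close> has cancelled, the excess over the margin is a positive multiple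
  of \<open>S - l *\<^sub>R mat 1\<close>, so both its symmetry and its sign come from
  \<open>S\<close>.\<close>

lemma M_full_margin:
  fixes B :: "real^'d^'m"
  assumes "rank B = CARD('d)" and "pos_def R" and "\<delta> > 0"
  shows "loewner_ge (H + transpose B ** M_full \<delta> H B R ** B) (\<delta> *\<^sub>R mat 1)"
proof -
  define S where "S = transpose B ** R ** B"
  have S: "pos_def S" using pos_def_congruence assms(1,2) by (simp add: S_def)
  define l where "l = lambda_min S"
  have l: "l > 0" using lambda_min_pos[OF S] by (simp add: l_def)
  have psd: "pos_semidef (S - l *\<^sub>R mat 1)"
    using loewner_ge_lambda_min S by (auto simp: pos_def_def loewner_ge_def l_def)
  have "H + transpose B ** M_full \<delta> H B R ** B = (\<delta> / l) *\<^sub>R S"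
    using transpose_mult_C_can_mult[OF assms(1), of H]
    by (simp add: M_full_def matrix_add_ldistrib matrix_add_rdistrib alpha_def S_def l_def
        matrix_scalar_ac flip: scalar_matrix_assoc)
  then have eq: "H + transpose B ** M_full \<delta> H B R ** B - \<delta> *\<^sub>R mat 1
      = (\<delta> / l) *\<^sub>R (S - l *\<^sub>R mat 1)"
    using l by (simp add: scaleR_diff_right)
  have "pos_semidef (c *\<^sub>R T)" if "pos_semidef T" "c \<ge> 0" for c and T :: "real^'d^'d"
    using that by (simp add: pos_semidef_def transpose_scalar flip: scaleR_matrix_vector_assoc)
  with psd eq l assms(3) show ?thesis
    by (simp add: loewner_ge_def)
qed

lemma C_aug_plus_C_opt:
  "C_aug \<delta> \<kappa>x \<kappa>p \<kappa>\<omega> H B R + C_opt \<delta> \<kappa>x \<kappa>p \<kappa>\<omega> B R = M_full \<delta> H B R"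
  by (simp add: C_aug_def C_opt_def M_full_def left_diff_distrib scaleR_diff_left)

lemma alg_primal_cong:
  fixes f :: "real^'d \<Rightarrow> real" and h :: "real^'d \<Rightarrow> real^'m"
  assumes sum: "C + \<Omega> = C' + \<Omega>'"
    and init: "\<mu> + C *v h x_prev = \<mu>' + C' *v h x_prev"
  shows "alg_primal f h \<eta>x \<eta>d C \<Omega> x_prev x_init \<mu> s
       = alg_primal f h \<eta>x \<eta>d C' \<Omega>' x_prev x_init \<mu>' s"
proof -
  \<comment> \<open>The invariant also matches the previous iterate \<open>y\<close>, which enters
    the next dual step. The duals \<open>\<nu>\<close> and \<open>\<nu>'\<close> may differ; only
    the effective duals agree.\<close>
  have "\<exists>y x \<nu> \<nu>'. alg_state f h \<eta>x \<eta>d C \<Omega> x_prev x_init \<mu> s = (y, x, \<nu>) \<and>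
      alg_state f h \<eta>x \<eta>d C' \<Omega>' x_prev x_init \<mu>' s = (y, x, \<nu>') \<and>
      \<nu> + C *v h y = \<nu>' + C' *v h y"
  proof (induction s)
    case 0
    with init show ?case by simp
  next
    case (Suc s)
    then obtain y x \<nu> \<nu>' where
      st: "alg_state f h \<eta>x \<eta>d C \<Omega> x_prev x_init \<mu> s = (y, x, \<nu>)"
          "alg_state f h \<eta>x \<eta>d C' \<Omega>' x_prev x_init \<mu>' s = (y, x, \<nu>')"
      and inv: "\<nu> + C *v h y = \<nu>' + C' *v h y" by blast
    \<comment> \<open>Splitting \<open>D *v h x\<close> as
      \<open>D *v h y + D *v (h x - h y)\<close> exposes the old effective dual and the sum
      \<open>D + W\<close>.\<close>
    have regroup: "(m + \<eta>d *\<^sub>R h x + W *v (h x - h y)) + D *v h x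
        = (m + D *v h y) + \<eta>d *\<^sub>R h x + (D + W) *v (h x - h y)" for m D W
      by (simp add: algebra_simps)
    have inv_step: "(\<nu> + \<eta>d *\<^sub>R h x + \<Omega> *v (h x - h y)) + C *v h x
        = (\<nu>' + \<eta>d *\<^sub>R h x + \<Omega>' *v (h x - h y)) + C' *v h x"
      by (simp only: regroup sum inv)
    show ?case
      \<comment> \<open>Rewriting with \<open>inv_step\<close> makes the two new primal iterates
        syntactically equal, so reflexivity fixes the witnesses.\<close>
      unfolding alg_state.simps st Let_def prod.case inv_step
      by ((rule exI)+, (rule conjI, rule refl)+, rule inv_step)
  qed
  then show ?thesis by (auto simp: alg_primal_def)
qed

theorem theorem2:
  fixes f :: "real^'d \<Rightarrow> real"
    and h :: "real^'d \<Rightarrow> real^'m"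
    and x_t :: "real^'d" and \<mu>_t :: "real^'m"
    and H :: "real^'d^'d" and B :: "real^'d^'m"
    and R M Caug Copt :: "real^'m^'m"
    and \<delta> \<kappa>x \<kappa>p \<kappa>\<omega> :: real
  assumes "twice_cont_differentiable f" and "twice_cont_differentiable h"
    and "\<delta> > 0" and "\<kappa>x > 0" and "\<kappa>p > 0" and "\<kappa>\<omega> > 0"
    and H: "H = hessian (\<lambda>x. lagrangian f h x \<mu>_t) x_t"
    and B: "B = jacobian h (at x_t)"
    and M: "M = M_full \<delta> H B R"
    and Caug: "Caug = C_aug \<delta> \<kappa>x \<kappa>p \<kappa>\<omega> H B R"
    and Copt: "Copt = C_opt \<delta> \<kappa>x \<kappa>p \<kappa>\<omega> B R"
    and full_column_rank: "rank B = CARD('d)"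
    and "pos_def R"
  shows "loewner_ge (H + transpose B ** M ** B) (\<delta> *\<^sub>R mat 1) \<and>
    Caug + Copt = M \<and>
    (\<forall>C' \<Omega>' \<eta>x \<eta>d x_prev x_init \<mu>_init \<mu>_init'.
       (C', \<Omega>') \<in> {(0, M), (M, 0)} \<longrightarrow> \<eta>x > 0 \<longrightarrow> \<eta>d > 0 \<longrightarrow>
       \<mu>_init + Caug *v h x_prev = \<mu>_init' + C' *v h x_prev \<longrightarrow>
       (\<forall>s. alg_primal f h \<eta>x \<eta>d Caug Copt x_prev x_init \<mu>_init s
          = alg_primal f h \<eta>x \<eta>d C' \<Omega>' x_prev x_init \<mu>_init' s))"
proof (intro conjI allI impI)
  show "loewner_ge (H + transpose B ** M ** B) (\<delta> *\<^sub>R mat 1)"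
    unfolding M using full_column_rank \<open>pos_def R\<close> \<open>\<delta> > 0\<close> by (rule M_full_margin)
  show sum: "Caug + Copt = M"
    unfolding M Caug Copt by (rule C_aug_plus_C_opt)
  fix C' \<Omega>' \<eta>x \<eta>d x_prev x_init \<mu>_init \<mu>_init' s
  assume "(C', \<Omega>') \<in> {(0, M), (M, 0)}"
    and "\<mu>_init + Caug *v h x_prev = \<mu>_init' + C' *v h x_prev"
  with sum show "alg_primal f h \<eta>x \<eta>d Caug Copt x_prev x_init \<mu>_init s
      = alg_primal f h \<eta>x \<eta>d C' \<Omega>' x_prev x_init \<mu>_init' s"
    by (intro alg_primal_cong) auto
qed

end
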